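(* Let $M$ be a simple binary matroid. The following are equivalent. (i) $M$ is chordal. (ii) $M$ has no induced minor isomorphic to $M(C_4)$. (iii) $M$ has no induced restriction isomorphic to a member of $\{M(C_n):n\geq 4\}$.
   Context: A matroid $M$ is chordal if, for every circuit $D$ of $M$ with at least four elements, there exist circuits $D_1,D_2$ and an element $e$ with $D_1\cap D_2=\{e\}$ and $D=(D_1\cup D_2)-e$. All matroids are finite and simple; every contraction is immediately followed by simplification. An induced restriction of $M$ is $M|F$ for a flat $F$ of $M$; an induced minor is any matroid obtained by a sequence of contractions (followed by simplification) and restrictions to flats. $M(C_n)\cong U_{n-1,n}$ is the cycle matroid of the $n$-edge cycle. *)

theory Defs
  imports Main "HOL-Library.Z2"
begin

record 'a indep_system =
  ground :: "'a set"
  indep :: "'a set \<Rightarrow> bool"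

locale matroid =
  fixes M :: "'a indep_system"
  assumes finite_ground: "finite (ground M)"
    and indep_subset_ground: "indep M I \<Longrightarrow> I \<subseteq> ground M"
    and indep_empty: "indep M {}"
    and indep_hereditary: "indep M I \<Longrightarrow> J \<subseteq> I \<Longrightarrow> indep M J"
    and indep_augment: "indep M I \<Longrightarrow> indep M J \<Longrightarrow> card I < card J \<Longrightarrow>
      \<exists>x\<in>J - I. indep M (insert x I)"

definition circuit :: "'a indep_system \<Rightarrow> 'a set \<Rightarrow> bool" where
  "circuit M C \<longleftrightarrow> C \<subseteq> ground M \<and> \<not> indep M C \<and> (\<forall>D. D \<subset> C \<longrightarrow> indep M D)"

definition loop :: "'a indep_system \<Rightarrow> 'a \<Rightarrow> bool" where
  "loop M e \<longleftrightarrow> circuit M {e}"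

definition parallel :: "'a indep_system \<Rightarrow> 'a \<Rightarrow> 'a \<Rightarrow> bool" where
  "parallel M e f \<longleftrightarrow> e \<noteq> f \<and> circuit M {e, f}"

definition simple_matroid :: "'a indep_system \<Rightarrow> bool" where
  "simple_matroid M \<longleftrightarrow> (\<forall>e. \<not> loop M e) \<and> (\<forall>e f. \<not> parallel M e f)"

definition rank_of :: "'a indep_system \<Rightarrow> 'a set \<Rightarrow> nat" where
  "rank_of M X = Max (card ` {I. I \<subseteq> X \<and> indep M I})"

definition closure_of :: "'a indep_system \<Rightarrow> 'a set \<Rightarrow> 'a set" where
  "closure_of M X = {e \<in> ground M. rank_of M (insert e X) = rank_of M X}"

definition flat :: "'a indep_system \<Rightarrow> 'a set \<Rightarrow> bool" where
  "flat M F \<longleftrightarrow> F \<subseteq> ground M \<and> closure_of M F = F"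

definition restriction :: "'a indep_system \<Rightarrow> 'a set \<Rightarrow> 'a indep_system" where
  "restriction M X = \<lparr> ground = ground M \<inter> X, indep = (\<lambda>I. indep M I \<and> I \<subseteq> X) \<rparr>"

text \<open>A maximal independent subset of \<open>X\<close>.\<close>

definition basis_of :: "'a indep_system \<Rightarrow> 'a set \<Rightarrow> 'a set \<Rightarrow> bool" where
  "basis_of M X B \<longleftrightarrow> B \<subseteq> X \<and> indep M B \<and> (\<forall>I. B \<subset> I \<and> I \<subseteq> X \<longrightarrow> \<not> indep M I)"

definition contraction :: "'a indep_system \<Rightarrow> 'a set \<Rightarrow> 'a indep_system" where
  "contraction M T = \<lparr> ground = ground M - T,
     indep = (\<lambda>I. I \<subseteq> ground M - T \<and> (\<exists>B. basis_of M T B \<and> indep M (I \<union> B))) \<rparr>"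

text \<open>
  A simplification deletes all loops and all but one element of every parallel class.
  It depends on the choice of representatives (and is unique only up to isomorphism),
  so it is a relation: \<open>S\<close> is a choice of representatives.
\<close>

definition simplification :: "'a indep_system \<Rightarrow> 'a indep_system \<Rightarrow> bool" where
  "simplification M N \<longleftrightarrow>
     (\<exists>S. S \<subseteq> {e \<in> ground M. \<not> loop M e} \<and>
          (\<forall>e\<in>ground M. \<not> loop M e \<longrightarrow> (\<exists>!s. s \<in> S \<and> (s = e \<or> parallel M s e))) \<and>
          N = restriction M S)"

inductive induced_minor :: "'a indep_system \<Rightarrow> 'a indep_system \<Rightarrow> bool"
  for M :: "'a indep_system" where
  refl: "induced_minor M M"
| contract: "induced_minor M N \<Longrightarrow> T \<subseteq> ground N \<Longrightarrow>
    simplification (contraction N T) N' \<Longrightarrow> induced_minor M N'"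
| restrict_flat: "induced_minor M N \<Longrightarrow> flat N F \<Longrightarrow> induced_minor M (restriction N F)"

definition induced_restriction :: "'a indep_system \<Rightarrow> 'a indep_system \<Rightarrow> bool" where
  "induced_restriction M N \<longleftrightarrow> (\<exists>F. flat M F \<and> N = restriction M F)"

definition isomorphic :: "'a indep_system \<Rightarrow> 'b indep_system \<Rightarrow> bool" where
  "isomorphic M N \<longleftrightarrow> (\<exists>\<phi>. bij_betw \<phi> (ground M) (ground N) \<and>
     (\<forall>X\<subseteq>ground M. indep M X \<longleftrightarrow> indep N (\<phi> ` X)))"

text \<open>
  Representability over GF(2) (the type \<^typ>\<open>bit\<close>): \<open>A\<close> is a matrix with \<open>m\<close> rows and columns
  labelled by the ground set; a set is independent iff its family of columns is linearly
  independent (in particular, equal columns with different labels are dependent).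
\<close>

definition binary_matroid :: "'a indep_system \<Rightarrow> bool" where
  "binary_matroid M \<longleftrightarrow> (\<exists>(m::nat) (A :: nat \<Rightarrow> 'a \<Rightarrow> bit). \<forall>X\<subseteq>ground M.
     indep M X \<longleftrightarrow>
       (\<forall>c :: 'a \<Rightarrow> bit. (\<forall>i<m. (\<Sum>x\<in>X. c x * A i x) = 0) \<longrightarrow> (\<forall>x\<in>X. c x = 0)))"

definition chordal :: "'a indep_system \<Rightarrow> bool" where
  "chordal M \<longleftrightarrow> (\<forall>D. circuit M D \<and> card D \<ge> 4 \<longrightarrow>
     (\<exists>D1 D2 e. circuit M D1 \<and> circuit M D2 \<and> D1 \<inter> D2 = {e} \<and> D = (D1 \<union> D2) - {e}))"

text \<open>
  A simple graph is given by its set of edges, each a two-element set of vertices.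
  The list \<open>vs\<close> enumerates the vertices of a cycle in cyclic order.
\<close>

definition cycle_edges :: "'v list \<Rightarrow> 'v set set" where
  "cycle_edges vs = {{vs ! i, vs ! (Suc i mod length vs)} | i. i < length vs}"

definition graph_cycle :: "'v set set \<Rightarrow> bool" where
  "graph_cycle C \<longleftrightarrow> (\<exists>vs. length vs \<ge> 3 \<and> distinct vs \<and> C = cycle_edges vs)"

definition cycle_matroid :: "'v set set \<Rightarrow> 'v set indep_system" where
  "cycle_matroid G = \<lparr> ground = G, indep = (\<lambda>X. X \<subseteq> G \<and> (\<forall>C\<subseteq>X. \<not> graph_cycle C)) \<rparr>"

text \<open>The graph \<open>C\<^sub>n\<close> on the vertices \<open>0, \<dots>, n - 1\<close>; meaningful for \<open>n \<ge> 3\<close>.\<close>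

definition cycle_graph :: "nat \<Rightarrow> nat set set" where
  "cycle_graph n = cycle_edges [0..<n]"

end

theory Submission
  imports Defs
begin

text \<open>
  A binary matroid is handled through its cycle space \<open>K\<close>: the family of sets of columns with
  zero sum, which is closed under symmetric difference. Restriction to \<open>S\<close> keeps the cycles inside
  \<open>S\<close>, and contraction of \<open>T\<close> replaces every cycle \<open>X\<close> by \<open>X - T\<close>.

  An element \<open>e\<close> in the closure of a circuit \<open>D\<close> but not in \<open>D\<close> splits \<open>D\<close> into two circuits that
  meet in \<open>e\<close>. Hence a simple binary matroid is chordal iff no circuit with at least four elements
  is a flat, and such flat circuits are exactly the induced restrictions \<open>M(C\<^sub>n)\<close> with \<open>n \<ge> 4\<close>.
  Contracting all but four elements of a flat circuit gives \<open>M(C\<^sub>4)\<close>. Conversely, a flat circuit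
  \<open>D\<close> of the simplification of \<open>M / T\<close> lifts to \<open>M\<close>: among the cycles of \<open>M\<close> in the closure of
  \<open>D \<union> T\<close> that meet the parallel class of every \<open>d \<in> D\<close> in an odd number of elements, one of
  minimum size is a flat circuit, because any proper cycle inside it or any chord would split it
  into two cycles, one of which again meets all classes oddly and is smaller.
\<close>

section \<open>Cycle spaces: circuits and spanning\<close>

locale cycle_space =
  fixes M :: "'a indep_system" and K :: "'a set set"
  assumes finite_E: "finite (ground M)"
    and cycle_subset: "X \<in> K \<Longrightarrow> X \<subseteq> ground M"
    and empty_cycle: "{} \<in> K"
    and sym_diff_cycle: "X \<in> K \<Longrightarrow> Y \<in> K \<Longrightarrow> sym_diff X Y \<in> K"
    and indep_iff: "indep M X \<longleftrightarrow> X \<subseteq> ground M \<and> (\<forall>Y\<in>K. Y \<subseteq> X \<longrightarrow> Y = {})"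
begin

lemma circuit_iff:
  "circuit M D \<longleftrightarrow> D \<in> K \<and> D \<noteq> {} \<and> (\<forall>Y\<in>K. Y \<subseteq> D \<longrightarrow> Y = {} \<or> Y = D)"
proof
  assume c: "circuit M D"
  then obtain Y where Y: "Y \<in> K" "Y \<subseteq> D" "Y \<noteq> {}"
    unfolding circuit_def indep_iff by blast
  have *: "Z = D" if "Z \<in> K" "Z \<subseteq> D" "Z \<noteq> {}" for Z
  proof (rule ccontr)
    assume "Z \<noteq> D"
    then have "indep M Z" using c that unfolding circuit_def by blast
    then show False using that unfolding indep_iff by blast
  qed
  show "D \<in> K \<and> D \<noteq> {} \<and> (\<forall>Y\<in>K. Y \<subseteq> D \<longrightarrow> Y = {} \<or> Y = D)"
    using * Y by blast
next
  assume a: "D \<in> K \<and> D \<noteq> {} \<and> (\<forall>Y\<in>K. Y \<subseteq> D \<longrightarrow> Y = {} \<or> Y = D)"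
  then have "D \<subseteq> ground M" using cycle_subset by blast
  then show "circuit M D" unfolding circuit_def indep_iff using a by blast
qed

text \<open>\<open>sym_diff S A \<in> K\<close> plays the role of "\<open>S\<close> and
  \<open>A\<close> have the same column sum". Expressions of single elements over \<open>I\<close>
  can therefore be added up modulo 2.\<close>

lemma spanned_subset:
  assumes "finite S" "\<And>x. x \<in> S \<Longrightarrow> \<exists>A\<subseteq>I. sym_diff {x} A \<in> K"
  shows "\<exists>A\<subseteq>I. sym_diff S A \<in> K"
  using assms
proof (induction S rule: finite_induct)
  case empty
  then show ?case using empty_cycle by (intro exI[of _ "{}"]) auto
next
  case (insert x S)
  obtain A where A: "A \<subseteq> I" "sym_diff S A \<in> K" using insert by blast
  obtain B where B: "B \<subseteq> I" "sym_diff {x} B \<in> K" using insert by blast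
  have "sym_diff (sym_diff S A) (sym_diff {x} B) = sym_diff (insert x S) (sym_diff A B)"
    using \<open>x \<notin> S\<close> by blast
  moreover have "sym_diff A B \<subseteq> I" using A B by blast
  ultimately show ?case using sym_diff_cycle[OF A(2) B(2)] by metis
qed

text \<open>Reducing subsets of \<open>J\<close> modulo cycles to subsets of \<open>I\<close> is injective,
  so \<open>2 ^ card J \<le> 2 ^ card I\<close>.\<close>

lemma indep_card_le_spanning:
  assumes J: "indep M J" and I: "finite I"
    and sp: "\<And>x. x \<in> J \<Longrightarrow> \<exists>A\<subseteq>I. sym_diff {x} A \<in> K"
  shows "card J \<le> card I"
proof -
  have finJ: "finite J" using J finite_E finite_subset unfolding indep_iff by blast
  have "\<forall>S\<in>Pow J. \<exists>A\<subseteq>I. sym_diff S A \<in> K"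
    using spanned_subset sp finJ finite_subset by (metis PowD subsetD)
  then obtain g where g: "\<And>S. S \<subseteq> J \<Longrightarrow> g S \<subseteq> I \<and> sym_diff S (g S) \<in> K"
    by (metis PowI)
  have "inj_on g (Pow J)"
  proof (rule inj_onI)
    fix S S' assume S: "S \<in> Pow J" "S' \<in> Pow J" "g S = g S'"
    have "sym_diff (sym_diff S (g S)) (sym_diff S' (g S')) = sym_diff S S'"
      using S(3) by blast
    then have "sym_diff S S' \<in> K" using sym_diff_cycle g S by (metis PowD)
    moreover have "sym_diff S S' \<subseteq> J" using S by blast
    ultimately have "sym_diff S S' = {}" using J unfolding indep_iff by blast
    then show "S = S'" by blast
  qed
  moreover have "g ` Pow J \<subseteq> Pow I" using g by blast
  ultimately have "card (Pow J) \<le> card (Pow I)"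
    using I by (metis card_inj_on_le finite_Pow_iff)
  then show ?thesis using I finJ by (simp add: card_Pow)
qed

section \<open>Rank, closure and flats in terms of cycles\<close>

lemma rank_witness:
  assumes "X \<subseteq> ground M"
  obtains I where "I \<subseteq> X" "indep M I" "card I = rank_of M X"
proof -
  let ?S = "card ` {I. I \<subseteq> X \<and> indep M I}"
  have "finite X" using assms finite_E finite_subset by blast
  then have "finite ?S" by simp
  moreover have "indep M {}" by (auto simp: indep_iff)
  then have "?S \<noteq> {}" by blast
  ultimately have "rank_of M X \<in> ?S" unfolding rank_of_def by (rule Max_in)
  then show ?thesis using that by auto
qed

lemma indep_card_le_rank:
  assumes "X \<subseteq> ground M" "I \<subseteq> X" "indep M I"
  shows "card I \<le> rank_of M X"
proof -
  have "finite X" using assms finite_E finite_subset by blast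
  then show ?thesis unfolding rank_of_def using assms by (intro Max_ge) auto
qed

lemma spanned_if_dependent:
  assumes "indep M I" "x \<in> ground M" "\<not> indep M (insert x I)"
  shows "\<exists>A\<subseteq>I. sym_diff {x} A \<in> K"
proof -
  obtain Y where Y: "Y \<in> K" "Y \<subseteq> insert x I" "Y \<noteq> {}"
    using assms unfolding indep_iff by blast
  then have "x \<in> Y" using assms(1) unfolding indep_iff by blast
  show ?thesis
  proof (cases "x \<in> I")
    case True
    then show ?thesis using empty_cycle by (intro exI[of _ "{x}"]) simp
  next
    case False
    then have "sym_diff {x} (Y - {x}) = Y" using \<open>x \<in> Y\<close> by blast
    then show ?thesis using Y by (intro exI[of _ "Y - {x}"]) auto
  qed
qed

text \<open>A largest independent \<open>I\<close> in \<open>X\<close> expresses all of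
  \<open>X\<close>. If \<open>e\<close> is expressible over \<open>X\<close>, it is so over
  \<open>I\<close> by composing expressions, and counting against \<open>I\<close> shows that adding
  \<open>e\<close> does not raise the rank.\<close>

lemma closure_iff:
  assumes X: "X \<subseteq> ground M"
  shows "e \<in> closure_of M X \<longleftrightarrow> e \<in> ground M \<and> (\<exists>A\<subseteq>X. sym_diff {e} A \<in> K)"
proof (cases "e \<in> ground M")
  case e: True
  then have eX: "insert e X \<subseteq> ground M" using X by simp
  obtain I where I: "I \<subseteq> X" "indep M I" "card I = rank_of M X"
    using rank_witness[OF X] .
  have finI: "finite I" using I X finite_E finite_subset by (metis subset_trans)
  have sp: "\<exists>A\<subseteq>I. sym_diff {x} A \<in> K" if x: "x \<in> X" for x
  proof (cases "x \<in> I")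
    case True
    then show ?thesis using empty_cycle by (intro exI[of _ "{x}"]) simp
  next
    case False
    have "\<not> indep M (insert x I)"
      using indep_card_le_rank[OF X, of "insert x I"] I x False finI by auto
    then show ?thesis using spanned_if_dependent I X x by blast
  qed
  show ?thesis
  proof
    assume cl: "e \<in> closure_of M X"
    show "e \<in> ground M \<and> (\<exists>A\<subseteq>X. sym_diff {e} A \<in> K)"
    proof (cases "e \<in> I")
      case True
      then show ?thesis using e empty_cycle I by (intro conjI exI[of _ "{e}"]) auto
    next
      case False
      have "\<not> indep M (insert e I)"
        using indep_card_le_rank[OF eX, of "insert e I"] I False finI cl
        unfolding closure_of_def by auto
      then show ?thesis using spanned_if_dependent I e by (meson subset_trans)
    qed
  next
    assume "e \<in> ground M \<and> (\<exists>A\<subseteq>X. sym_diff {e} A \<in> K)"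
    then obtain A where A: "A \<subseteq> X" "sym_diff {e} A \<in> K" by blast
    have "finite A" using A X finite_E finite_subset by (metis subset_trans)
    then obtain B where B: "B \<subseteq> I" "sym_diff A B \<in> K"
      using spanned_subset[of A I] sp A(1) by (meson subsetD)
    have "sym_diff (sym_diff {e} A) (sym_diff A B) = sym_diff {e} B" by blast
    then have "sym_diff {e} B \<in> K" using sym_diff_cycle[OF A(2) B(2)] by simp
    then have sp': "\<exists>A\<subseteq>I. sym_diff {x} A \<in> K" if "x \<in> insert e X" for x
      using that sp B(1) by blast
    obtain J where J: "J \<subseteq> insert e X" "indep M J" "card J = rank_of M (insert e X)"
      using rank_witness[OF eX] .
    have "rank_of M (insert e X) \<le> rank_of M X"
      using indep_card_le_spanning[OF J(2) finI] sp' J I by (metis subsetD)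
    moreover have "rank_of M X \<le> rank_of M (insert e X)"
      using indep_card_le_rank[OF eX, of I] I by auto
    ultimately show "e \<in> closure_of M X" using e unfolding closure_of_def by simp
  qed
qed (simp add: closure_of_def)

text \<open>The set \<open>A\<close> may contain \<open>e\<close>; that case is harmless, since then
  \<open>e\<close> lies in \<open>F\<close> anyway.\<close>

lemma flat_iff:
  "flat M F \<longleftrightarrow> F \<subseteq> ground M \<and>
     (\<forall>e\<in>ground M. \<forall>A\<subseteq>F. sym_diff {e} A \<in> K \<longrightarrow> e \<in> F)"
proof (cases "F \<subseteq> ground M")
  case True
  have "F \<subseteq> closure_of M F"
  proof
    fix e assume "e \<in> F"
    then have "{e} \<subseteq> F" "sym_diff {e} {e} \<in> K" "e \<in> ground M"
      using empty_cycle True by auto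
    then show "e \<in> closure_of M F" unfolding closure_iff[OF True] by blast
  qed
  then have "flat M F \<longleftrightarrow> closure_of M F \<subseteq> F" using True unfolding flat_def by auto
  also have "\<dots> \<longleftrightarrow> (\<forall>e\<in>ground M. \<forall>A\<subseteq>F. sym_diff {e} A \<in> K \<longrightarrow> e \<in> F)"
    unfolding subset_iff[of "closure_of M F"] closure_iff[OF True] by metis
  finally show ?thesis using True by simp
qed (simp add: flat_def)

section \<open>Simplicity and chordality in terms of cycles\<close>

lemma simple_iff: "simple_matroid M \<longleftrightarrow> (\<forall>X\<in>K. X \<noteq> {} \<longrightarrow> 3 \<le> card X)"
proof
  assume s: "simple_matroid M"
  have no1: "{e} \<notin> K" for e
    using s circuit_iff[of "{e}"] unfolding simple_matroid_def loop_def by blast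
  have no2: "{e, f} \<notin> K" for e f
  proof
    assume a: "{e, f} \<in> K"
    then have ef: "e \<noteq> f" using no1 by auto
    have "Y = {} \<or> Y = {e} \<or> Y = {f} \<or> Y = {e, f}" if "Y \<subseteq> {e, f}" for Y
      using that by blast
    then have "circuit M {e, f}" unfolding circuit_iff using a no1 by blast
    then show False using s ef unfolding simple_matroid_def parallel_def by blast
  qed
  show "\<forall>X\<in>K. X \<noteq> {} \<longrightarrow> 3 \<le> card X"
  proof (intro ballI impI)
    fix X assume X: "X \<in> K" "X \<noteq> {}"
    have "finite X" using X finite_E finite_subset cycle_subset by blast
    then have "card X \<noteq> 0" using X by simp
    moreover have "card X \<noteq> 1" using X no1 by (metis card_1_singletonE)
    moreover have "card X \<noteq> 2" using X no2 by (metis card_2_iff)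
    ultimately show "3 \<le> card X" by linarith
  qed
next
  assume k: "\<forall>X\<in>K. X \<noteq> {} \<longrightarrow> 3 \<le> card X"
  have "\<not> loop M e" for e
    using k unfolding loop_def circuit_iff by fastforce
  moreover have "\<not> parallel M e f" for e f
    using k unfolding parallel_def circuit_iff by fastforce
  ultimately show "simple_matroid M" unfolding simple_matroid_def by blast
qed

lemma chordal_iff:
  assumes "simple_matroid M"
  shows "chordal M \<longleftrightarrow> \<not> (\<exists>D. circuit M D \<and> flat M D \<and> 4 \<le> card D)"
proof
  assume ch: "chordal M"
  show "\<not> (\<exists>D. circuit M D \<and> flat M D \<and> 4 \<le> card D)"
  proof
    assume "\<exists>D. circuit M D \<and> flat M D \<and> 4 \<le> card D"
    then obtain D where D: "circuit M D" "flat M D" "4 \<le> card D" by blast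
    then obtain D1 D2 e where e: "circuit M D1" "circuit M D2" "D1 \<inter> D2 = {e}"
      "D = (D1 \<union> D2) - {e}" using ch unfolding chordal_def by meson
    then have "sym_diff {e} (D1 - {e}) = D1" by blast
    then have "sym_diff {e} (D1 - {e}) \<in> K" using e circuit_iff by simp
    moreover have "e \<in> ground M" using e unfolding circuit_def by blast
    moreover have "D1 - {e} \<subseteq> D" using e by blast
    ultimately have "e \<in> D" using D(2) unfolding flat_iff by blast
    then show False using e by blast
  qed
next
  assume nf: "\<not> (\<exists>D. circuit M D \<and> flat M D \<and> 4 \<le> card D)"
  show "chordal M" unfolding chordal_def
  proof (intro allI impI)
    fix D assume D: "circuit M D \<and> 4 \<le> card D"
    then have DK: "D \<in> K" and Dmin: "\<And>Y. Y \<in> K \<Longrightarrow> Y \<subseteq> D \<Longrightarrow> Y = {} \<or> Y = D"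
      unfolding circuit_iff by blast+
    have "\<not> flat M D" using nf D by blast
    then obtain e A where e: "e \<in> ground M" "A \<subseteq> D" "sym_diff {e} A \<in> K" "e \<notin> D"
      using cycle_subset[OF DK] unfolding flat_iff by blast
    \<comment> \<open>A cycle \<open>Y\<close> inside \<open>insert e B\<close> that contains
      \<open>e\<close> differs from it by a cycle properly inside \<open>D\<close>, hence by
      nothing. One that avoids \<open>e\<close> is a cycle inside \<open>D\<close>, and
      \<open>Y = D\<close> would force \<open>B = D\<close> and make \<open>e\<close> a
      loop.\<close>
    have *: "circuit M (insert e B)" if B: "B \<subseteq> D" "insert e B \<in> K" for B
      unfolding circuit_iff
    proof (intro conjI ballI impI)
      fix Y assume Y: "Y \<in> K" "Y \<subseteq> insert e B"
      show "Y = {} \<or> Y = insert e B"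
      proof (cases "e \<in> Y")
        case True
        then have "sym_diff (insert e B) Y \<subset> D" using Y B e
        proof -
          have "{e} \<notin> K" using assms simple_iff by fastforce
          then have "Y \<noteq> {e}" using Y by blast
          then show ?thesis using Y B e True by blast
        qed
        then have "sym_diff (insert e B) Y = {}"
          using Dmin sym_diff_cycle[OF B(2) Y(1)] by blast
        then show ?thesis by blast
      next
        case False
        then have "Y \<subseteq> B" using Y by blast
        moreover have "Y \<noteq> D"
        proof
          assume "Y = D"
          then have "B = D" using \<open>Y \<subseteq> B\<close> B by blast
          then have "sym_diff (insert e B) D = {e}" using e by blast
          then have "{e} \<in> K" using sym_diff_cycle[OF B(2) DK] by simp
          then show False using assms simple_iff by fastforce
        qed
        ultimately show ?thesis using Dmin Y B by blast
      qed
    qed (use B in auto)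
    have "sym_diff {e} A = insert e A" using e by blast
    then have eA: "insert e A \<in> K" using e by simp
    \<comment> \<open>Adding \<open>D\<close> to the first cycle through \<open>e\<close> yields the
      complementary one.\<close>
    have "sym_diff (insert e A) D = insert e (D - A)" using e by blast
    then have eDA: "insert e (D - A) \<in> K" using sym_diff_cycle[OF eA DK] by simp
    have "circuit M (insert e A)" "circuit M (insert e (D - A))"
      using * e eA eDA by blast+
    moreover have "insert e A \<inter> insert e (D - A) = {e}"
      "D = insert e A \<union> insert e (D - A) - {e}" using e by blast+
    ultimately show "\<exists>D1 D2 e. circuit M D1 \<and> circuit M D2 \<and> D1 \<inter> D2 = {e} \<and>
      D = D1 \<union> D2 - {e}" by blast
  qed
qed

section \<open>Restriction, contraction and simplification\<close>

lemma cycle_space_restriction: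
  "cycle_space (restriction M S) {X \<in> K. X \<subseteq> S}"
proof
  fix X
  have "(\<forall>Y\<in>{X \<in> K. X \<subseteq> S}. Y \<subseteq> X \<longrightarrow> Y = {}) \<longleftrightarrow> (\<forall>Y\<in>K. Y \<subseteq> X \<longrightarrow> Y = {})"
    if "X \<subseteq> S"
    using that by (auto dest: subset_trans)
  then show "indep (restriction M S) X \<longleftrightarrow> X \<subseteq> ground (restriction M S) \<and>
    (\<forall>Y\<in>{X \<in> K. X \<subseteq> S}. Y \<subseteq> X \<longrightarrow> Y = {})"
    unfolding restriction_def by (simp add: indep_iff) blast
next
  fix X Y assume "X \<in> {X \<in> K. X \<subseteq> S}" "Y \<in> {X \<in> K. X \<subseteq> S}"
  then show "sym_diff X Y \<in> {X \<in> K. X \<subseteq> S}" using sym_diff_cycle by blast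
next
  fix X assume "X \<in> {X \<in> K. X \<subseteq> S}"
  then show "X \<subseteq> ground (restriction M S)" using cycle_subset by (simp add: restriction_def)
next
  show "{} \<in> {X \<in> K. X \<subseteq> S}" using empty_cycle by simp
  show "finite (ground (restriction M S))" using finite_E by (simp add: restriction_def)
qed

lemma basis_exists:
  assumes "T \<subseteq> ground M"
  obtains B where "basis_of M T B"
proof -
  obtain B where B: "B \<subseteq> T" "indep M B" "card B = rank_of M T"
    using rank_witness[OF assms] .
  have "\<not> indep M I" if "B \<subset> I" "I \<subseteq> T" for I
  proof
    assume "indep M I"
    then have "card I \<le> card B" using indep_card_le_rank[OF assms that(2)] B by simp
    moreover have "finite I" using that assms finite_E by (meson finite_subset)
    ultimately show False using that psubset_card_mono by (metis leD)
  qed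
  then have "basis_of M T B" using B unfolding basis_of_def by blast
  then show ?thesis by (rule that)
qed

text \<open>If \<open>I \<union> B\<close> is independent for a basis \<open>B\<close> of
  \<open>T\<close> and a cycle \<open>X\<close> has \<open>X - T \<subseteq> I\<close>, the part of
  \<open>X\<close> in \<open>T\<close> can be rewritten over \<open>B\<close>, giving a cycle inside
  \<open>I \<union> B\<close>, which must be empty. Conversely, a cycle inside
  \<open>I \<union> B\<close> has its part outside \<open>T\<close> in \<open>I\<close>; that part
  vanishes, so the cycle lies in the independent set \<open>B\<close>.\<close>

lemma cycle_space_contraction:
  assumes T: "T \<subseteq> ground M"
  shows "cycle_space (contraction M T) ((\<lambda>X. X - T) ` K)"
proof
  show "sym_diff X Y \<in> (\<lambda>X. X - T) ` K"
    if XY: "X \<in> (\<lambda>X. X - T) ` K" "Y \<in> (\<lambda>X. X - T) ` K" for X Y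
  proof -
    obtain X' Y' where X': "X' \<in> K" "X = X' - T" "Y' \<in> K" "Y = Y' - T" using XY by blast
    then have "sym_diff X Y = sym_diff X' Y' - T" by blast
    then show ?thesis using X' sym_diff_cycle by blast
  qed
  fix I
  show "indep (contraction M T) I \<longleftrightarrow> I \<subseteq> ground (contraction M T) \<and>
    (\<forall>Y\<in>(\<lambda>X. X - T) ` K. Y \<subseteq> I \<longrightarrow> Y = {})" (is "?L \<longleftrightarrow> ?R")
  proof
    assume L: ?L
    then obtain B where I: "I \<subseteq> ground M - T" and B: "basis_of M T B" "indep M (I \<union> B)"
      unfolding contraction_def by auto
    have Bi: "B \<subseteq> T" "indep M B" using B unfolding basis_of_def by blast+
    have sp: "\<exists>A\<subseteq>B. sym_diff {x} A \<in> K" if "x \<in> T" for x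
    proof (cases "x \<in> B")
      case True
      then show ?thesis using empty_cycle by (intro exI[of _ "{x}"]) simp
    next
      case False
      then have "\<not> indep M (insert x B)" using B(1) that unfolding basis_of_def by blast
      then show ?thesis using spanned_if_dependent Bi T that by blast
    qed
    have "X - T = {}" if X: "X \<in> K" "X - T \<subseteq> I" for X
    proof -
      have "finite (X \<inter> T)" using T finite_E by (meson finite_Int finite_subset)
      then obtain A where A: "A \<subseteq> B" "sym_diff (X \<inter> T) A \<in> K"
        using spanned_subset[of "X \<inter> T" B] sp by (meson IntD2)
      have "sym_diff X (sym_diff (X \<inter> T) A) = (X - T) \<union> A" using A Bi by blast
      then have "(X - T) \<union> A \<in> K" using sym_diff_cycle[OF X(1) A(2)] by simp
      moreover have "(X - T) \<union> A \<subseteq> I \<union> B" using A X by blast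
      ultimately have "(X - T) \<union> A = {}" using B(2) indep_iff by metis
      then show ?thesis by blast
    qed
    then show ?R using I unfolding contraction_def by auto
  next
    assume R: ?R
    obtain B where B: "basis_of M T B" using basis_exists[OF T] .
    have "indep M (I \<union> B)"
      unfolding indep_iff
    proof (intro conjI ballI impI)
      show "I \<union> B \<subseteq> ground M" using R B T unfolding contraction_def basis_of_def by auto
      fix Y assume Y: "Y \<in> K" "Y \<subseteq> I \<union> B"
      then have "Y - T \<subseteq> I" using B unfolding basis_of_def by blast
      then have "Y - T = {}" using R Y by blast
      then have "Y \<subseteq> B" using Y R unfolding contraction_def by auto
      then show "Y = {}" using B Y unfolding basis_of_def indep_iff by blast
    qed
    then show ?L using R B unfolding contraction_def by auto
  qed
next
  show "finite (ground (contraction M T))" using finite_E by (simp add: contraction_def)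
  show "{} \<in> (\<lambda>X. X - T) ` K" using empty_cycle by (intro image_eqI[of _ _ "{}"]) auto
  show "X \<subseteq> ground (contraction M T)" if "X \<in> (\<lambda>X. X - T) ` K" for X
    using that cycle_subset by (fastforce simp: contraction_def)
qed

text \<open>Two parallel representatives \<open>e\<close> and \<open>f\<close> would both represent
  \<open>f\<close>, against uniqueness.\<close>

lemma simplification_simple:
  assumes "simplification M N"
  shows "simple_matroid N"
proof -
  obtain S where S: "S \<subseteq> {e \<in> ground M. \<not> loop M e}"
    "\<forall>e\<in>ground M. \<not> loop M e \<longrightarrow> (\<exists>!s. s \<in> S \<and> (s = e \<or> parallel M s e))"
    "N = restriction M S"
    using assms unfolding simplification_def by (elim exE conjE)
  interpret N: cycle_space N "{X \<in> K. X \<subseteq> S}"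
    using cycle_space_restriction S by simp
  have circ: "circuit M D" "D \<subseteq> S" if "circuit N D" for D
    using that unfolding circuit_iff N.circuit_iff by auto
  have "\<not> loop N e" for e
    using circ S unfolding loop_def by fastforce
  moreover have "\<not> parallel N e f" for e f
  proof
    assume p: "parallel N e f"
    then have "parallel M e f" "e \<in> S" "f \<in> S" "e \<noteq> f"
      using circ[of "{e, f}"] unfolding parallel_def by auto
    moreover have "f \<in> ground M" "\<not> loop M f" using \<open>f \<in> S\<close> S by auto
    ultimately show False using S(2) by blast
  qed
  ultimately show ?thesis unfolding simple_matroid_def by blast
qed

lemma loop_iff: "loop M e \<longleftrightarrow> {e} \<in> K"
  unfolding loop_def circuit_iff by blast

lemma parallel_cycle: "parallel M e f \<Longrightarrow> {e, f} \<in> K"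
  unfolding parallel_def circuit_iff by blast

lemma sym_diff_cycle_cancel: "sym_diff X Y \<in> K \<Longrightarrow> sym_diff Y Z \<in> K \<Longrightarrow> sym_diff X Z \<in> K"
proof -
  assume "sym_diff X Y \<in> K" "sym_diff Y Z \<in> K"
  then have "sym_diff (sym_diff X Y) (sym_diff Y Z) \<in> K" by (rule sym_diff_cycle)
  moreover have "sym_diff (sym_diff X Y) (sym_diff Y Z) = sym_diff X Z" by blast
  ultimately show ?thesis by simp
qed

end

section \<open>Lifting flat circuits through induced minors\<close>

lemma odd_card_sym_diff:
  assumes "finite A" "finite B"
  shows "odd (card (sym_diff A B)) \<longleftrightarrow> odd (card A) \<noteq> odd (card B)"
proof -
  have "card (sym_diff A B) = card (A - B) + card (B - A)"
    using assms by (intro card_Un_disjoint) auto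
  moreover have "card A = card (A - B) + card (A \<inter> B)"
    using assms by (metis card_Diff_subset_Int card_mono Int_lower1 finite_Int le_add_diff_inverse2)
  moreover have "card B = card (B - A) + card (A \<inter> B)"
    using assms by (metis card_Diff_subset_Int card_mono Int_lower1 finite_Int le_add_diff_inverse2
        Int_commute)
  ultimately show ?thesis by presburger
qed

context cycle_space
begin

lemma flat_circuit_lift_contraction:
  assumes simple: "simple_matroid M" and T: "T \<subseteq> ground M"
    and N: "simplification (contraction M T) N"
    and D: "circuit N D" "flat N D" "4 \<le> card D"
  shows "\<exists>Z. circuit M Z \<and> flat M Z \<and> 4 \<le> card Z"
proof -
  let ?C = "contraction M T"
  define L where "L = (\<lambda>X. X - T) ` K"
  interpret C: cycle_space ?C L unfolding L_def using cycle_space_contraction[OF T] .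
  obtain S where S: "S \<subseteq> {e \<in> ground ?C. \<not> loop ?C e}"
    "\<forall>e\<in>ground ?C. \<not> loop ?C e \<longrightarrow> (\<exists>!s. s \<in> S \<and> (s = e \<or> parallel ?C s e))"
    "N = restriction ?C S"
    using N unfolding simplification_def by (elim exE conjE)
  interpret N: cycle_space N "{X \<in> L. X \<subseteq> S}"
    using C.cycle_space_restriction[of S] S(3) by simp
  have groundC: "ground ?C = ground M - T" by (simp add: contraction_def)
  have LK: "X - T \<in> L" if "X \<in> K" for X using that unfolding L_def by blast
  note D0 = D(1)[unfolded N.circuit_iff]
  have D1: "D \<in> L" "D \<subseteq> S" using D0 by simp_all
  have D2: "Y = {} \<or> Y = D" if "Y \<in> L" "Y \<subseteq> D" for Y
    using D0 D1(2) that by (metis (no_types, lifting) mem_Collect_eq subset_trans)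
  have DE: "D \<subseteq> ground M - T" using D1(1) C.cycle_subset groundC by blast
  have D_single: "{d} \<notin> L" if "d \<in> D" for d
    using D2[of "{d}"] that D(3) by auto
  \<comment> \<open>For \<open>d\<close> in \<open>D\<close> this is the parallel class of
    \<open>d\<close> in the contraction. An element of \<open>T\<close> never enters it, since the
    condition would then read \<open>{d} \<in> L\<close>.\<close>
  define cls where "cls d = {e \<in> ground M. sym_diff {e} {d} - T \<in> L}" for d
  have cls_unique: "d = d'" if d: "d \<in> D" "d' \<in> D" "e \<in> cls d" "e \<in> cls d'" for d d' e
  proof (rule ccontr)
    assume "d \<noteq> d'"
    have "sym_diff (sym_diff {e} {d} - T) (sym_diff {e} {d'} - T) \<in> L"
      using d unfolding cls_def by (intro C.sym_diff_cycle) auto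
    moreover have "sym_diff (sym_diff {e} {d} - T) (sym_diff {e} {d'} - T) = {d, d'}"
      using d DE \<open>d \<noteq> d'\<close> by blast
    ultimately have "{d, d'} = D" using D2[of "{d, d'}"] d by auto
    then have "card D \<le> 2" by (metis card_2_iff \<open>d \<noteq> d'\<close> order_refl)
    then show False using D(3) by simp
  qed
  have self_cls: "d \<in> cls d" if "d \<in> D" for d
    using that DE C.empty_cycle unfolding cls_def by auto
  \<comment> \<open>\<open>p\<close> replaces each element by its representative in
    \<open>D\<close>, counted modulo 2, and drops elements outside all classes. It is linear over
    GF(2).\<close>
  define p where "p Z = {d \<in> D. odd (card (Z \<inter> cls d))}" for Z
  have p_sub: "p Z \<subseteq> D" for Z unfolding p_def by blast
  have p_sym_diff: "p (sym_diff X Y) = sym_diff (p X) (p Y)" if "finite X" "finite Y" for X Y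
  proof -
    have "odd (card (sym_diff X Y \<inter> cls d)) \<longleftrightarrow>
      odd (card (X \<inter> cls d)) \<noteq> odd (card (Y \<inter> cls d))" for d
    proof -
      have "sym_diff X Y \<inter> cls d = sym_diff (X \<inter> cls d) (Y \<inter> cls d)" by blast
      then show ?thesis using odd_card_sym_diff[of "X \<inter> cls d" "Y \<inter> cls d"] that by simp
    qed
    then show ?thesis unfolding p_def by auto
  qed
  \<comment> \<open>This is the closure of \<open>D \<union> T\<close> in \<open>M\<close>: the
    elements of \<open>T\<close>, the loops of the contraction, and the classes of
    \<open>D\<close>.\<close>
  define G where "G = {e \<in> ground M. {e} - T \<in> L \<or> (\<exists>d\<in>D. e \<in> cls d)}"
  have finG: "finite Z" if "Z \<subseteq> G" for Z
    by (rule finite_subset[OF _ finite_E]) (use that in \<open>auto simp: G_def\<close>)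
  have p_single: "sym_diff {e} (p {e}) - T \<in> L" if e: "e \<in> G" for e
  proof (cases "\<exists>d\<in>D. e \<in> cls d")
    case True
    then obtain d where d: "d \<in> D" "e \<in> cls d" by blast
    have "d' \<in> p {e} \<longleftrightarrow> d' = d" for d'
    proof -
      have "{e} \<inter> cls d' = (if e \<in> cls d' then {e} else {})" by auto
      then show ?thesis using d cls_unique unfolding p_def by auto
    qed
    then have "p {e} = {d}" by blast
    then show ?thesis using d unfolding cls_def by auto
  next
    case False
    then have "p {e} = {}" unfolding p_def by auto
    then show ?thesis using e False unfolding G_def by auto
  qed
  \<comment> \<open>Modulo the cycles of the contraction, \<open>Z\<close> and \<open>p Z\<close>
    agree; by linearity this follows from single elements.\<close>
  have p_cong: "sym_diff Z (p Z) - T \<in> L" if "Z \<subseteq> G" for Z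
    using finG[OF that] that
  proof (induction Z rule: finite_induct)
    case empty
    have "p {} = {}" unfolding p_def by simp
    then show ?case using C.empty_cycle by simp
  next
    case (insert x F)
    have "insert x F = sym_diff {x} F" using insert by blast
    then have "p (insert x F) = sym_diff (p {x}) (p F)" using p_sym_diff[of "{x}" F] insert by simp
    then have "sym_diff (insert x F) (p (insert x F)) - T =
      sym_diff (sym_diff {x} (p {x}) - T) (sym_diff F (p F) - T)"
      using \<open>insert x F = sym_diff {x} F\<close> by auto
    moreover have "sym_diff {x} (p {x}) - T \<in> L" "sym_diff F (p F) - T \<in> L"
      using p_single insert by auto
    ultimately show ?case using C.sym_diff_cycle by metis
  qed
  \<comment> \<open>By the congruence, \<open>p Z\<close> is a cycle of the contraction contained in
    the circuit \<open>D\<close>.\<close>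
  have p_cycle: "p Z = {} \<or> p Z = D" if Z: "Z \<in> K" "Z \<subseteq> G" for Z
  proof -
    have "sym_diff (Z - T) (sym_diff Z (p Z) - T) \<in> L"
      using LK[OF Z(1)] p_cong[OF Z(2)] by (rule C.sym_diff_cycle)
    moreover have "sym_diff (Z - T) (sym_diff Z (p Z) - T) = p Z"
      using p_sub[of Z] DE by blast
    ultimately show ?thesis using D2 p_sub by metis
  qed
  define good where "good Z \<longleftrightarrow> Z \<in> K \<and> Z \<subseteq> G \<and> p Z = D" for Z
  \<comment> \<open>Any cycle \<open>X\<close> of \<open>M\<close> with \<open>X - T = D\<close>
    meets each class in exactly its representative.\<close>
  have "\<exists>Z. good Z"
  proof -
    obtain X where X: "X \<in> K" "D = X - T" using D1 unfolding L_def by blast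
    have "X \<subseteq> G"
    proof
      fix e assume e: "e \<in> X"
      show "e \<in> G"
      proof (cases "e \<in> T")
        case True
        then have "{e} - T = {}" by blast
        then show ?thesis using True T C.empty_cycle unfolding G_def by auto
      next
        case False
        then have "e \<in> D" using X e by blast
        then show ?thesis using self_cls[of e] DE unfolding G_def by auto
      qed
    qed
    moreover have "d \<in> p X" if d: "d \<in> D" for d
    proof -
      have "e = d" if e: "e \<in> X" "e \<in> cls d" for e
      proof (cases "e \<in> T")
        case True
        then have "sym_diff {e} {d} - T = {d}" using d DE by blast
        then have "{d} \<in> L" using e unfolding cls_def by simp
        then show ?thesis using D_single d by blast
      next
        case False
        then have "e \<in> D" using X e by blast
        then show ?thesis using cls_unique[OF _ d self_cls e(2)] by blast
      qed
      then have "X \<inter> cls d = {d}" using self_cls[OF d] X d by blast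
      then show ?thesis using d unfolding p_def by simp
    qed
    ultimately show ?thesis using X p_sub unfolding good_def by blast
  qed
  then obtain Z where Z: "good Z" and Zmin: "\<And>Y. good Y \<Longrightarrow> card Z \<le> card Y"
    by (metis ex_has_least_nat)
  have ZK: "Z \<in> K" and ZG: "Z \<subseteq> G" and pZ: "p Z = D" using Z unfolding good_def by blast+
  have finZ: "finite Z" using finG ZG .
  \<comment> \<open>\<open>Z\<close> meets every class, and classes of distinct elements of
    \<open>D\<close> are disjoint, so \<open>Z\<close> has at least as many elements as
    \<open>D\<close>.\<close>
  have "4 \<le> card Z"
  proof -
    have "\<exists>e. e \<in> Z \<and> e \<in> cls d" if "d \<in> D" for d
    proof (rule ccontr)
      assume "\<not> (\<exists>e. e \<in> Z \<and> e \<in> cls d)"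
      then have "Z \<inter> cls d = {}" by blast
      then have "d \<notin> p Z" unfolding p_def by simp
      then show False using pZ that by simp
    qed
    then obtain f where f: "\<And>d. d \<in> D \<Longrightarrow> f d \<in> Z \<and> f d \<in> cls d" by metis
    have "inj_on f D" using f cls_unique by (metis inj_onI)
    then have "card D \<le> card Z" using f finZ by (meson card_inj_on_le image_subsetI)
    then show ?thesis using D(3) by simp
  qed
  \<comment> \<open>If \<open>p X\<close> is empty, linearity gives the other cycle all of
    \<open>p Z = D\<close>. Minimality of \<open>Z\<close> is played against this alternative, first
    for subcycles and then for chords.\<close>
  have split: "p X = D \<or> p (sym_diff Z X) = D" if X: "X \<in> K" "X \<subseteq> G" for X
    using p_cycle[OF X] p_sym_diff[OF finZ finG[OF X(2)]] pZ by auto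
  have "circuit M Z"
    unfolding circuit_iff
  proof (intro conjI ballI impI)
    show "Z \<noteq> {}" using \<open>4 \<le> card Z\<close> by auto
    fix Y assume Y: "Y \<in> K" "Y \<subseteq> Z"
    then have YG: "Y \<subseteq> G" using ZG by blast
    have "sym_diff Z Y = Z - Y" using Y by blast
    then have c: "Z - Y \<in> K" using sym_diff_cycle[OF ZK Y(1)] by simp
    have "p Y = D \<or> p (Z - Y) = D" using split[OF Y(1) YG] \<open>sym_diff Z Y = Z - Y\<close> by simp
    then have "good Y \<or> good (Z - Y)" using Y YG ZG c unfolding good_def by blast
    then have "card Z \<le> card Y \<or> card Z \<le> card (Z - Y)" using Zmin by blast
    then have "Y = Z \<or> Z - Y = Z" using finZ Y(2) by (metis card_seteq Diff_subset)
    then show "Y = {} \<or> Y = Z" using Y by blast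
  qed (use ZK in auto)
  moreover have "flat M Z"
    unfolding flat_iff
  proof (intro conjI ballI allI impI)
    show "Z \<subseteq> ground M" using ZK cycle_subset by blast
    fix e A assume e: "e \<in> ground M" "A \<subseteq> Z" "sym_diff {e} A \<in> K"
    show "e \<in> Z"
    proof (rule ccontr)
      assume "e \<notin> Z"
      have AG: "A \<subseteq> G" using e ZG by blast
      have "sym_diff (sym_diff {e} A - T) (sym_diff A (p A) - T) \<in> L"
        using LK[OF e(3)] p_cong[OF AG] by (rule C.sym_diff_cycle)
      moreover have "sym_diff (sym_diff {e} A - T) (sym_diff A (p A) - T)
        = sym_diff {e} (p A) - T" by blast
      ultimately have epA: "sym_diff {e} (p A) - T \<in> L" by simp
      \<comment> \<open>Flatness of \<open>D\<close> enters here: unless \<open>e\<close> is in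
        \<open>T\<close> or a loop of the contraction, its representative \<open>s\<close> is in the
        closure of \<open>D\<close> in \<open>N\<close>, hence in \<open>D\<close>, and
        \<open>e\<close> is in the class of \<open>s\<close>.\<close>
      have eG: "e \<in> G"
      proof (cases "{e} - T \<in> L")
        case True
        then show ?thesis using e unfolding G_def by blast
      next
        case False
        then have eT: "e \<notin> T" using C.empty_cycle by (metis Diff_insert0 Diff_eq_empty_iff empty_subsetI insert_subset)
        then have "{e} - T = {e}" by blast
        then have "{e} \<notin> L" using False by simp
        then have "\<not> loop ?C e" using C.loop_iff by simp
        then obtain s where s: "s \<in> S" "s = e \<or> parallel ?C s e"
          using S(2) e(1) eT groundC by blast
        have se: "sym_diff {s} {e} \<in> L"
        proof (cases "s = e")
          case True
          then show ?thesis using C.empty_cycle by simp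
        next
          case False
          then have "sym_diff {s} {e} = {s, e}" by blast
          then show ?thesis using C.parallel_cycle[of s e] s False by simp
        qed
        have "sym_diff {e} (p A) - T = sym_diff {e} (p A)"
          using eT p_sub[of A] DE by blast
        then have "sym_diff {e} (p A) \<in> L" using epA by simp
        then have "sym_diff {s} (p A) \<in> L" using C.sym_diff_cycle_cancel[OF se] by blast
        moreover have "sym_diff {s} (p A) \<subseteq> S" using s(1) p_sub[of A] D1(2) by blast
        moreover have "s \<in> ground N" using s S by (auto simp: restriction_def)
        ultimately have "s \<in> D" using D(2) p_sub[of A] unfolding N.flat_iff by blast
        moreover have "e \<in> cls s"
        proof -
          have "sym_diff {e} {s} - T = sym_diff {s} {e}"
            using eT \<open>s \<in> D\<close> DE by blast
          then show ?thesis using se e(1) unfolding cls_def by simp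
        qed
        ultimately show ?thesis using e(1) unfolding G_def by blast
      qed
      have eq: "sym_diff {e} A = insert e A" "sym_diff Z (insert e A) = insert e (Z - A)"
        using e \<open>e \<notin> Z\<close> by blast+
      have k: "insert e A \<in> K" using e(3) eq by simp
      have k': "insert e (Z - A) \<in> K" using sym_diff_cycle[OF ZK k] eq by simp
      have g: "insert e A \<subseteq> G" "insert e (Z - A) \<subseteq> G" using eG AG ZG by blast+
      have "good (insert e A) \<or> good (insert e (Z - A))"
        using split[OF k g(1)] eq(2) k k' g unfolding good_def by simp
      then have "card Z \<le> card (insert e A) \<or> card Z \<le> card (insert e (Z - A))"
        using Zmin by blast
      \<comment> \<open>By simplicity \<open>A\<close> and \<open>Z - A\<close> each have at least
        two elements, so both cycles through \<open>e\<close> are strictly smaller than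
        \<open>Z\<close>.\<close>
      moreover have "3 \<le> card (insert e A)" "3 \<le> card (insert e (Z - A))"
        using bspec[OF simple[unfolded simple_iff] k] bspec[OF simple[unfolded simple_iff] k']
        by simp_all
      moreover have "card (insert e A) = Suc (card A)" "card (insert e (Z - A)) = Suc (card (Z - A))"
        using finZ e \<open>e \<notin> Z\<close> by (auto intro!: card_insert_disjoint finite_subset[of A Z])
      moreover have "card (Z - A) = card Z - card A" "card A \<le> card Z"
        using finZ e by (auto simp: card_Diff_subset finite_subset card_mono)
      ultimately show False by linarith
    qed
  qed
  ultimately show ?thesis using \<open>4 \<le> card Z\<close> by blast
qed

text \<open>An element spanned by \<open>D\<close> lies in the flat \<open>F\<close>, hence in the
  restriction, where \<open>D\<close> is closed.\<close>

lemma flat_circuit_lift_restriction: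
  assumes F: "flat M F" and D: "circuit (restriction M F) D" "flat (restriction M F) D"
  shows "circuit M D \<and> flat M D"
proof -
  interpret N: cycle_space "restriction M F" "{X \<in> K. X \<subseteq> F}"
    using cycle_space_restriction .
  have c: "circuit M D" "D \<subseteq> F" using D(1) unfolding circuit_iff N.circuit_iff by auto
  have "e \<in> D" if e: "e \<in> ground M" "A \<subseteq> D" "sym_diff {e} A \<in> K" for e A
  proof -
    have "A \<subseteq> F" using e c by blast
    then have "e \<in> F" using F e unfolding flat_iff by blast
    moreover have "sym_diff {e} A \<subseteq> F" using \<open>e \<in> F\<close> \<open>A \<subseteq> F\<close> by blast
    ultimately show ?thesis using D(2) e unfolding N.flat_iff
      by (auto simp: restriction_def)
  qed
  then have "flat M D" unfolding flat_iff using c cycle_subset circuit_iff by blast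
  then show ?thesis using c by blast
qed

lemma simple_restriction:
  assumes "simple_matroid M"
  shows "simple_matroid (restriction M F)"
proof -
  interpret N: cycle_space "restriction M F" "{X \<in> K. X \<subseteq> F}"
    using cycle_space_restriction .
  show ?thesis using assms unfolding simple_iff N.simple_iff by blast
qed

text \<open>A cycle space and simplicity are carried along the induction, because lifting across a
  contraction requires both of the matroid being contracted.\<close>

lemma induced_minor_flat_circuit_lift:
  assumes "induced_minor M N" and simple: "simple_matroid M"
  shows "(\<exists>L. cycle_space N L) \<and> simple_matroid N \<and>
    ((\<exists>D. circuit N D \<and> flat N D \<and> 4 \<le> card D) \<longrightarrow>
     (\<exists>D. circuit M D \<and> flat M D \<and> 4 \<le> card D))"
  using assms(1)
proof induction
  case refl
  then show ?case using simple cycle_space_axioms by blast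
next
  case (contract N T N')
  then obtain L where L: "cycle_space N L" by blast
  interpret N: cycle_space N L by fact
  interpret C: cycle_space "contraction N T" "(\<lambda>X. X - T) ` L"
    using N.cycle_space_contraction contract.hyps by blast
  obtain S where "N' = restriction (contraction N T) S"
    using contract.hyps unfolding simplification_def by blast
  then have "\<exists>L. cycle_space N' L" using C.cycle_space_restriction by blast
  moreover have "simple_matroid N'" using C.simplification_simple contract.hyps by blast
  ultimately show ?case
    using N.flat_circuit_lift_contraction[OF _ contract.hyps(2,3)] contract.IH by blast
next
  case (restrict_flat N F)
  then obtain L where L: "cycle_space N L" by blast
  interpret N: cycle_space N L by fact
  show ?case
    using N.cycle_space_restriction N.simple_restriction N.flat_circuit_lift_restriction
      restrict_flat by blast
qed

lemma simplification_of_simple: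
  assumes "simple_matroid M"
  shows "simplification M (restriction M (ground M))"
  unfolding simplification_def
  using assms by (intro exI[of _ "ground M"]) (auto simp: simple_matroid_def)

lemma flat_ground: "flat M (ground M)"
  unfolding flat_iff by simp

end

section \<open>From matrices over GF(2) to cycle spaces\<close>

text \<open>Over GF(2) a coefficient vector is the indicator of its support, so linear dependences
  are the sets of columns with zero sum. In the sum of two such sets the common columns occur twice
  and cancel.\<close>

lemma binary_matroid_cycle_space:
  assumes "matroid M" "binary_matroid M"
  shows "\<exists>K. cycle_space M K"
proof -
  interpret matroid M by fact
  obtain m :: nat and A :: "nat \<Rightarrow> 'a \<Rightarrow> bit" where A: "\<And>X. X \<subseteq> ground M \<Longrightarrow> indep M X \<longleftrightarrow>
       (\<forall>c :: 'a \<Rightarrow> bit. (\<forall>i<m. (\<Sum>x\<in>X. c x * A i x) = 0) \<longrightarrow> (\<forall>x\<in>X. c x = 0))"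
    using assms(2) unfolding binary_matroid_def by blast
  define K where "K = {X. X \<subseteq> ground M \<and> (\<forall>i<m. (\<Sum>x\<in>X. A i x) = 0)}"
  have add_cancel: "a + b = (a + x) + (b + x)" for a b x :: bit
    by (cases a; cases b; cases x) simp_all
  have fin: "finite X" if "X \<subseteq> ground M" for X using that finite_ground finite_subset by blast
  have "cycle_space M K"
  proof
    show "finite (ground M)" by (rule finite_ground)
    show "{} \<in> K" unfolding K_def by simp
    show "X \<subseteq> ground M" if "X \<in> K" for X using that unfolding K_def by blast
    show "sym_diff X Y \<in> K" if XY: "X \<in> K" "Y \<in> K" for X Y
    proof -
      have f: "finite X" "finite Y" using XY fin unfolding K_def by blast+
      have "(\<Sum>x\<in>sym_diff X Y. A i x) = 0" if "i < m" for i
      proof -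
        have "(\<Sum>x\<in>sym_diff X Y. A i x) = (\<Sum>x\<in>X - Y. A i x) + (\<Sum>x\<in>Y - X. A i x)"
          using f by (intro sum.union_disjoint) auto
        also have "\<dots> = ((\<Sum>x\<in>X - Y. A i x) + (\<Sum>x\<in>X \<inter> Y. A i x)) +
            ((\<Sum>x\<in>Y - X. A i x) + (\<Sum>x\<in>X \<inter> Y. A i x))"
          using add_cancel by blast
        also have "\<dots> = (\<Sum>x\<in>X. A i x) + (\<Sum>x\<in>Y. A i x)"
          using sum.Int_Diff[OF f(1), of "A i" Y] sum.Int_Diff[OF f(2), of "A i" X]
          by (simp only: Int_commute add.commute)
        also have "\<dots> = 0" using XY that unfolding K_def by simp
        finally show ?thesis .
      qed
      then show ?thesis using XY unfolding K_def by blast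
    qed
    fix X
    show "indep M X \<longleftrightarrow> X \<subseteq> ground M \<and> (\<forall>Y\<in>K. Y \<subseteq> X \<longrightarrow> Y = {})"
    proof (cases "X \<subseteq> ground M")
      case True
      have sum_eq: "(\<Sum>x\<in>X. c x * A i x) = (\<Sum>x\<in>{x \<in> X. c x = 1}. A i x)" for c i
      proof -
        have "(\<Sum>x\<in>X. c x * A i x) = (\<Sum>x\<in>X. if c x = 1 then A i x else 0)"
          by (intro sum.cong) auto
        then show ?thesis using fin[OF True] by (simp add: sum.inter_filter)
      qed
      show ?thesis
      proof
        assume ind: "indep M X"
        have "Y = {}" if Y: "Y \<in> K" "Y \<subseteq> X" for Y
        proof -
          define c :: "'a \<Rightarrow> bit" where "c x = (if x \<in> Y then 1 else 0)" for x
          have "{x \<in> X. c x = 1} = Y" using Y unfolding c_def by auto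
          then have "\<forall>i<m. (\<Sum>x\<in>X. c x * A i x) = 0" using Y sum_eq unfolding K_def by simp
          then have "\<forall>x\<in>X. c x = 0" using A[OF True] ind by blast
          then have "x \<notin> Y" if "x \<in> X" for x using that unfolding c_def by force
          then show ?thesis using Y(2) by blast
        qed
        then show "X \<subseteq> ground M \<and> (\<forall>Y\<in>K. Y \<subseteq> X \<longrightarrow> Y = {})" using True by blast
      next
        assume R: "X \<subseteq> ground M \<and> (\<forall>Y\<in>K. Y \<subseteq> X \<longrightarrow> Y = {})"
        have "\<forall>x\<in>X. c x = 0" if "\<forall>i<m. (\<Sum>x\<in>X. c x * A i x) = 0" for c
        proof -
          have "{x \<in> X. c x = 1} \<in> K" using that True unfolding sum_eq K_def by blast
          moreover have "{x \<in> X. c x = 1} \<subseteq> X" by (rule Collect_subset)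
          ultimately have "{x \<in> X. c x = 1} = {}" using R by meson
          then show ?thesis by auto
        qed
        then show "indep M X" using A[OF True] by blast
      qed
    qed (use indep_subset_ground in blast)
  qed
  then show ?thesis by blast
qed

section \<open>Cycle graphs and their matroids\<close>

lemma cycle_graph_eq: "cycle_graph n = (\<lambda>i. {i, Suc i mod n}) ` {..<n}"
proof -
  have "{[0..<n] ! i, [0..<n] ! (Suc i mod length [0..<n])} = {i, Suc i mod n}" if "i < n" for i
  proof -
    have "Suc i mod n < n" using that by (intro mod_less_divisor) simp
    then show ?thesis using that by simp
  qed
  then show ?thesis unfolding cycle_graph_def cycle_edges_def setcompr_eq_image
    by (intro image_cong) auto
qed

text \<open>The bound on \<open>n\<close> keeps the edges distinct: for \<open>n = 2\<close> both
  indices give the same edge.\<close>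

lemma card_cycle_graph:
  assumes "3 \<le> n"
  shows "card (cycle_graph n) = n"
proof -
  have "inj_on (\<lambda>i. {i, Suc i mod n}) {..<n}"
    using assms by (intro inj_onI) (auto simp: doubleton_eq_iff mod_Suc split: if_splits)
  then show ?thesis unfolding cycle_graph_eq by (simp add: card_image)
qed

lemma edge_cycle_graph_iff:
  "{a, b} \<in> cycle_graph n \<longleftrightarrow> a < n \<and> b < n \<and> (b = Suc a mod n \<or> a = Suc b mod n)"
proof -
  have "Suc i mod n < n" if "i < n" for i using that by (intro mod_less_divisor) simp
  then show ?thesis unfolding cycle_graph_eq by (auto simp: doubleton_eq_iff)
qed

lemma graph_cycle_neighbours:
  assumes "3 \<le> length vs" "distinct vs" "v \<in> set vs"
  shows "\<exists>a b. a \<in> set vs \<and> b \<in> set vs \<and> a \<noteq> b \<and> {v, a} \<in> cycle_edges vs \<and> {v, b} \<in> cycle_edges vs"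
proof -
  let ?k = "length vs"
  obtain j where j: "j < ?k" "v = vs ! j" using assms(3) by (metis in_set_conv_nth)
  \<comment> \<open>The cyclic predecessor of \<open>j\<close>; it differs from the successor
    because the length is at least three.\<close>
  define i where "i = (if j = 0 then ?k - 1 else j - 1)"
  have i: "i < ?k" "Suc i mod ?k = j" using j assms(1) unfolding i_def by (auto split: if_splits)
  have s: "Suc j mod ?k < ?k" using j by (intro mod_less_divisor) linarith
  have "Suc j mod ?k \<noteq> i"
    using j assms(1) unfolding i_def by (auto simp: mod_Suc split: if_splits)
  then have "vs ! (Suc j mod ?k) \<noteq> vs ! i" using assms(2) s i by (simp add: nth_eq_iff_index_eq)
  moreover have "{v, vs ! (Suc j mod ?k)} \<in> cycle_edges vs"
    unfolding cycle_edges_def using j by blast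
  moreover have "{vs ! i, vs ! (Suc i mod ?k)} \<in> cycle_edges vs"
    unfolding cycle_edges_def using i(1) by blast
  then have "{v, vs ! i} \<in> cycle_edges vs" using i(2) j by (simp add: insert_commute)
  ultimately show ?thesis using s i by (metis nth_mem)
qed

text \<open>A vertex of the \<open>n\<close>-cycle has only its predecessor and its successor as
  neighbours, while a cycle supplies two distinct neighbours at each of its vertices. It therefore
  always uses the edge to the successor and runs through all vertices.\<close>

lemma graph_cycle_subset_cycle_graph:
  assumes n: "3 \<le> n" and C: "C \<subseteq> cycle_graph n"
  shows "graph_cycle C \<longleftrightarrow> C = cycle_graph n"
proof
  assume "graph_cycle C"
  then obtain vs where vs: "3 \<le> length vs" "distinct vs" "C = cycle_edges vs"
    unfolding graph_cycle_def by blast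
  have step: "{v, Suc v mod n} \<in> C \<and> Suc v mod n \<in> set vs \<and> v < n" if v: "v \<in> set vs" for v
  proof -
    obtain a b where ab: "a \<in> set vs" "b \<in> set vs" "a \<noteq> b" "{v, a} \<in> C" "{v, b} \<in> C"
      using graph_cycle_neighbours[OF vs(1,2) v] vs(3) by blast
    then have "{v, a} \<in> cycle_graph n" "{v, b} \<in> cycle_graph n" using C by blast+
    then have *: "v < n" "a < n" "b < n" "a = Suc v mod n \<or> v = Suc a mod n"
      "b = Suc v mod n \<or> v = Suc b mod n"
      unfolding edge_cycle_graph_iff by blast+
    \<comment> \<open>Predecessors are unique, so one of \<open>a\<close> and \<open>b\<close> is
      the successor.\<close>
    have "\<not> (v = Suc a mod n \<and> v = Suc b mod n)"
      using *(2,3) ab(3) by (auto simp: mod_Suc split: if_splits)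
    then have "a = Suc v mod n \<or> b = Suc v mod n" using * by blast
    then show ?thesis using ab * by blast
  qed
  define v where "v = vs ! 0"
  have v: "v \<in> set vs" using vs(1) unfolding v_def by (intro nth_mem) linarith
  have reach: "(v + i) mod n \<in> set vs" for i
  proof (induction i)
    case 0
    then show ?case using v step[OF v] by simp
  next
    case (Suc i)
    then show ?case using step[of "(v + i) mod n"] by (simp add: mod_Suc_eq)
  qed
  have "w \<in> set vs" if "w < n" for w
  proof -
    \<comment> \<open>From \<open>v\<close>, \<open>n - v\<close> steps lead to vertex 0 and
      \<open>w\<close> more to \<open>w\<close>; the subtraction is not truncated as
      \<open>v < n\<close>.\<close>
    have "v + (n - v + w) = w + n" using step[OF v] by simp
    then have "(v + (n - v + w)) mod n = w" using that by simp
    then show ?thesis using reach[of "n - v + w"] by simp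
  qed
  then have "cycle_graph n \<subseteq> C" using step unfolding cycle_graph_eq by auto
  then show "C = cycle_graph n" using C by blast
next
  assume "C = cycle_graph n"
  then show "graph_cycle C"
    unfolding graph_cycle_def cycle_graph_def using n by (intro exI[of _ "[0..<n]"]) simp
qed

text \<open>The full edge set is the only dependent set of edges of the \<open>n\<close>-cycle.
  Every bijection of ground sets is thus an isomorphism exactly when the whole ground set is the
  only dependent set of \<open>N\<close>.\<close>

lemma isomorphic_cycle_matroid_iff:
  assumes n: "3 \<le> n"
  shows "isomorphic N (cycle_matroid (cycle_graph n)) \<longleftrightarrow>
    card (ground N) = n \<and> circuit N (ground N)"
proof -
  let ?G = "cycle_graph n"
  have ind: "indep (cycle_matroid ?G) X \<longleftrightarrow> X \<noteq> ?G" if "X \<subseteq> ?G" for X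
  proof -
    have "graph_cycle C \<longleftrightarrow> C = ?G" if "C \<subseteq> X" for C
      using graph_cycle_subset_cycle_graph[OF n, of C] that \<open>X \<subseteq> ?G\<close> by blast
    then have "(\<forall>C\<subseteq>X. \<not> graph_cycle C) \<longleftrightarrow> X \<noteq> ?G"
      using that by (metis subset_antisym order_refl)
    then show ?thesis using that unfolding cycle_matroid_def by simp
  qed
  have gr: "ground (cycle_matroid ?G) = ?G" unfolding cycle_matroid_def by simp
  have circ: "circuit N (ground N) \<longleftrightarrow> (\<forall>X\<subseteq>ground N. indep N X \<longleftrightarrow> X \<noteq> ground N)"
    unfolding circuit_def by blast
  have *: "(\<forall>X\<subseteq>ground N. indep N X \<longleftrightarrow> indep (cycle_matroid ?G) (\<phi> ` X)) \<longleftrightarrow>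
      circuit N (ground N)" if b: "bij_betw \<phi> (ground N) ?G" for \<phi>
  proof -
    have "indep (cycle_matroid ?G) (\<phi> ` X) \<longleftrightarrow> X \<noteq> ground N" if "X \<subseteq> ground N" for X
    proof -
      have "\<phi> ` X \<subseteq> ?G" using b that unfolding bij_betw_def by blast
      moreover have "\<phi> ` X = \<phi> ` ground N \<longleftrightarrow> X = ground N"
        using b that by (intro inj_on_image_eq_iff[of _ "ground N"]) (auto simp: bij_betw_def)
      ultimately show ?thesis using ind b unfolding bij_betw_def by simp
    qed
    then show ?thesis unfolding circ by blast
  qed
  have "(\<exists>\<phi>. bij_betw \<phi> (ground N) ?G) \<longleftrightarrow> card (ground N) = n"
  proof
    assume "\<exists>\<phi>. bij_betw \<phi> (ground N) ?G"
    then show "card (ground N) = n" using bij_betw_same_card card_cycle_graph[OF n] by metis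
  next
    assume "card (ground N) = n"
    \<comment> \<open>Infinite sets have \<open>card\<close> 0, which \<open>3 \<le> n\<close>
      excludes.\<close>
    moreover have "finite (ground N)" "finite ?G"
      using calculation card_cycle_graph[OF n] n by (auto intro: card_ge_0_finite)
    ultimately show "\<exists>\<phi>. bij_betw \<phi> (ground N) ?G"
      using card_cycle_graph[OF n] by (intro finite_same_card_bij) auto
  qed
  then show ?thesis unfolding isomorphic_def gr using * by blast
qed

section \<open>The equivalences\<close>

context cycle_space
begin

lemma induced_minor_C4_if_flat_circuit:
  assumes D: "circuit M D" "flat M D" "4 \<le> card D"
  shows "\<exists>N. induced_minor M N \<and> isomorphic N (cycle_matroid (cycle_graph 4))"
proof -
  have DE: "D \<subseteq> ground M" using D(1) unfolding circuit_def by blast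
  have finD: "finite D" using DE finite_E finite_subset by blast
  \<comment> \<open>After restricting to the flat \<open>D\<close>, contracting \<open>T\<close>
    leaves four elements.\<close>
  obtain T where T: "T \<subseteq> D" "card T = card D - 4"
    by (metis diff_le_self obtain_subset_with_card_n)
  have card4: "card (D - T) = 4"
    using T D(3) finD by (simp add: card_Diff_subset finite_subset)
  let ?R = "restriction M D"
  let ?C = "contraction ?R T"
  let ?L = "{X \<in> K. X \<subseteq> D}"
  let ?N = "restriction ?C (ground ?C)"
  interpret R: cycle_space ?R ?L by (rule cycle_space_restriction)
  have groundR: "ground ?R = D" using DE unfolding restriction_def by auto
  interpret C: cycle_space ?C "(\<lambda>X. X - T) ` ?L"
    using R.cycle_space_contraction T groundR by simp
  have groundC: "ground ?C = D - T" using groundR unfolding contraction_def by simp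
  have "?L = {{}, D}" using D(1) empty_cycle unfolding circuit_iff by blast
  then have L: "(\<lambda>X. X - T) ` ?L = {{}, D - T}" by auto
  have ne: "D - T \<noteq> {}" using card4 by (metis card.empty zero_neq_numeral)
  \<comment> \<open>The only non-empty cycle has four elements, so the contraction is already simple
    and its simplification may keep every element.\<close>
  have "simple_matroid ?C" unfolding C.simple_iff L using card4 by simp
  then have "simplification ?C ?N" by (rule C.simplification_of_simple)
  moreover have "induced_minor M ?R" using D by (intro restrict_flat refl)
  moreover have "T \<subseteq> ground ?R" using T groundR by simp
  ultimately have "induced_minor M ?N" by (metis contract)
  moreover have "circuit ?C (D - T)" unfolding C.circuit_iff L using ne by blast
  then have "circuit ?N (ground ?N)" "ground ?N = D - T"
    using groundC unfolding circuit_def restriction_def by auto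
  ultimately show ?thesis using isomorphic_cycle_matroid_iff[of 4 ?N] card4 by auto
qed

lemma circuit_restriction_ground_iff:
  assumes "F \<subseteq> ground M"
  shows "circuit (restriction M F) (ground (restriction M F)) \<longleftrightarrow> circuit M F"
    and "ground (restriction M F) = F"
  using assms by (auto simp: circuit_def restriction_def Int_absorb1)

end

theorem theorem2p2:
  fixes M :: "'a indep_system"
  assumes "matroid M" and "simple_matroid M" and "binary_matroid M"
  shows "(chordal M \<longleftrightarrow>
            \<not> (\<exists>N. induced_minor M N \<and> isomorphic N (cycle_matroid (cycle_graph 4)))) \<and>
         (chordal M \<longleftrightarrow>
            \<not> (\<exists>N n. induced_restriction M N \<and> n \<ge> 4 \<and>
                 isomorphic N (cycle_matroid (cycle_graph n))))"
proof -
  obtain K where "cycle_space M K" using binary_matroid_cycle_space assms by blast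
  then interpret cycle_space M K .
  \<comment> \<open>All three conditions are compared with this one, the negation of
    chordality.\<close>
  let ?P = "\<exists>D. circuit M D \<and> flat M D \<and> 4 \<le> card D"
  have "?P \<longleftrightarrow> (\<exists>N. induced_minor M N \<and> isomorphic N (cycle_matroid (cycle_graph 4)))"
  proof
    assume "\<exists>N. induced_minor M N \<and> isomorphic N (cycle_matroid (cycle_graph 4))"
    then obtain N where N: "induced_minor M N" "isomorphic N (cycle_matroid (cycle_graph 4))"
      by blast
    then obtain L where "cycle_space N L"
      using induced_minor_flat_circuit_lift assms(2) by blast
    \<comment> \<open>The ground set of \<open>N\<close> is itself a flat circuit with four
      elements, which lifts to \<open>M\<close>.\<close>
    then have "flat N (ground N)" by (rule cycle_space.flat_ground)
    moreover have "card (ground N) = 4" "circuit N (ground N)"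
      using N(2) isomorphic_cycle_matroid_iff[of 4 N] by simp_all
    ultimately show ?P
      using induced_minor_flat_circuit_lift[OF N(1) assms(2)] by (metis order_refl)
  qed (use induced_minor_C4_if_flat_circuit in blast)
  moreover have "?P \<longleftrightarrow> (\<exists>N n. induced_restriction M N \<and> n \<ge> 4 \<and>
      isomorphic N (cycle_matroid (cycle_graph n)))"
  proof
    assume ?P
    then obtain D where D: "circuit M D" "flat M D" "4 \<le> card D" by blast
    have "D \<subseteq> ground M" using D(1) unfolding circuit_def by blast
    then have "isomorphic (restriction M D) (cycle_matroid (cycle_graph (card D)))"
      using D circuit_restriction_ground_iff[of D] isomorphic_cycle_matroid_iff[of "card D" "restriction M D"]
      by simp
    then show "\<exists>N n. induced_restriction M N \<and> n \<ge> 4 \<and>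
      isomorphic N (cycle_matroid (cycle_graph n))"
      using D unfolding induced_restriction_def by blast
  next
    assume "\<exists>N n. induced_restriction M N \<and> n \<ge> 4 \<and>
      isomorphic N (cycle_matroid (cycle_graph n))"
    then obtain F n where F: "flat M F" "n \<ge> 4"
      "isomorphic (restriction M F) (cycle_matroid (cycle_graph n))"
      unfolding induced_restriction_def by blast
    have "F \<subseteq> ground M" using F(1) unfolding flat_def by blast
    then have "circuit M F" "card F = n"
      using F isomorphic_cycle_matroid_iff[of n "restriction M F"]
        circuit_restriction_ground_iff[of F] by auto
    then show ?P using F by blast
  qed
  ultimately show ?thesis unfolding chordal_iff[OF assms(2)] by blast
qed

end
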